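(* Let $n,d\ge1$ and $q,k\ge0$ be integers with $q\ge d$. Then the generalized Stirling number $\left\{{n\atop k}\right\}_{q,d}$ is given by $$\left\{{n\atop k}\right\}_{q,d}=\sum_{\substack{\lambda\vdash nd-k\\ \ell(\lambda)\le n-1}}c^{n,d}_\lambda\prod_i(q)_{\lambda_i},$$ where $(q)_j=q(q-1)\cdots(q-j+1)$ is the falling factorial.
   Context: Generalized Stirling numbers: let $\partial_x=\frac{d}{dx}$ act on $\mathbb{Z}[x]$, and let $x$ act by multiplication. For $q\ge d$, the numbers $\left\{{n\atop k}\right\}_{q,d}$ are the coefficients determined by the operator identity $$(x^q\partial_x^d)^n=x^{(q-d)n}\sum_k\left\{{n\atop k}\right\}_{q,d}x^k\partial_x^k .$$ For a partition $\lambda=(\lambda_1\ge\cdots\ge\lambda_\ell>0)$, $|\lambda|$ is the sum of its parts, $\lambda\vdash k$ means $|\lambda|=k$, and $\ell(\lambda)=\ell$ is its number of parts; $y_\lambda=\prod_{i=1}^{\ell}y_{\lambda_i}$, with $y_\emptyset=1$. Let $R=\mathbb{Z}[y_i;\ i\geq 0]$ be the commutative polynomial ring, and let $R\langle t\rangle$ be the unital ring generated over $\mathbb{Z}$ by $t$ and the $y_i$, subject only to $y_iy_j=y_jy_i$ for all $i,j\ge0$ (so $t$ does not commute with the $y_i$). Let $\Delta$ be the derivation of $R\langle t\rangle$ (additive, satisfying the Leibniz rule) with $\Delta(y_i)=y_{i+1}$ for all $i\ge0$ and $\Delta(t)=0$, and let $\rho_t$ be right multiplication by $t$. Define $U_{0,d}=1$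 and $U_{n+1,d}=y_0(\Delta+\rho_t)^dU_{n,d}$ for $n\ge0$. For $n,d\ge1$ the integers $c^{n,d}_\lambda$ are the coefficients in $$U_{n,d}=\sum_{k=d}^{nd}\ \sum_{\substack{\lambda\vdash nd-k\\ \ell(\lambda)\le n-1}}c^{n,d}_\lambda\,y_0^{\,n-\ell(\lambda)}y_\lambda t^k,$$ with $c^{n,d}_\lambda=0$ for all partitions $\lambda$ with $|\lambda|>(n-1)d$ or $\ell(\lambda)>n-1$. *)

theory Defs
  imports
    "HOL-Library.Multiset"
    "HOL-Library.Poly_Mapping"
    "HOL-Computational_Algebra.Polynomial"
begin

section \<open>Partitions and falling factorials\<close>

text \<open>A partition is identified with the multiset of its (positive) parts, so that
  the size of the partition is \<^term>\<open>sum_mset l\<close> and its length is \<^term>\<open>size l\<close>.\<close>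

definition is_partition :: "nat multiset \<Rightarrow> bool" where
  "is_partition l \<longleftrightarrow> 0 \<notin># l"

definition falling_fact :: "int \<Rightarrow> nat \<Rightarrow> int" where
  "falling_fact x j = (\<Prod>i<j. x - int i)"

lemma size_le_sum_mset_partition: "is_partition l \<Longrightarrow> size l \<le> sum_mset l"
  by (induction l) (auto simp: is_partition_def)

lemma finite_partitions: "finite {l. is_partition l \<and> sum_mset l \<le> m}"
proof (rule finite_subset)
  show "{l. is_partition l \<and> sum_mset l \<le> m} \<subseteq>
      (\<Union>j\<le>m. mset ` {xs. set xs \<subseteq> {..m} \<and> length xs = j})"
  proof
    fix l assume "l \<in> {l. is_partition l \<and> sum_mset l \<le> m}"
    then have l: "is_partition l" "sum_mset l \<le> m" by auto
    obtain xs where xs: "l = mset xs" using ex_mset[of l] by blast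
    have "set xs \<subseteq> {..m}"
    proof
      fix x assume "x \<in> set xs"
      then have "x \<le> sum_list xs" by (simp add: member_le_sum_list)
      with l show "x \<in> {..m}" by (simp add: xs sum_mset_sum_list)
    qed
    moreover have "length xs \<le> m"
      using size_le_sum_mset_partition[OF l(1)] l(2) by (simp add: xs)
    ultimately show "l \<in> (\<Union>j\<le>m. mset ` {xs. set xs \<subseteq> {..m} \<and> length xs = j})"
      using xs by blast
  qed
  show "finite (\<Union>j\<le>m. mset ` {xs. set xs \<subseteq> {..m} \<and> length xs = j})"
    by (simp add: finite_lists_length_eq)
qed

section \<open>Generalized Stirling numbers\<close>

definition xD :: "nat \<Rightarrow> nat \<Rightarrow> int poly \<Rightarrow> int poly" where
  "xD q d p = monom 1 q * (pderiv ^^ d) p"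

text \<open>A family of coefficients has finite support, so that the right-hand side of the
  operator identity is a finite sum of operators.\<close>

definition is_gen_stirling :: "nat \<Rightarrow> nat \<Rightarrow> nat \<Rightarrow> (nat \<Rightarrow> int) \<Rightarrow> bool" where
  "is_gen_stirling q d n S \<longleftrightarrow> finite {k. S k \<noteq> 0} \<and>
     (\<forall>p. (xD q d ^^ n) p = monom 1 ((q - d) * n) * (\<Sum>k | S k \<noteq> 0. smult (S k) (xD k k p)))"

definition gen_stirling :: "nat \<Rightarrow> nat \<Rightarrow> nat \<Rightarrow> nat \<Rightarrow> int" where
  "gen_stirling q d n = (THE S. is_gen_stirling q d n S)"

lemma xD_0 [simp]: "xD q d 0 = 0"
  by (simp add: xD_def)

lemma xD_add: "xD q d (p + r) = xD q d p + xD q d r"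
  by (simp add: xD_def higher_pderiv_add distrib_left)

lemma xD_smult: "xD q d (smult c p) = smult c (xD q d p)"
  by (simp add: xD_def higher_pderiv_smult)

lemma xD_sum: "xD q d (sum f A) = (\<Sum>x\<in>A. xD q d (f x))"
  by (induction A rule: infinite_finite_induct) (simp_all add: xD_add)

lemma coeff_xD_same: "coeff (xD k k (monom 1 m)) m = int (pochhammer (Suc m - k) k)" if "k \<le> m"
proof -
  have "pochhammer (int m - int k + 1) k = int (pochhammer (Suc m - k) k)"
  proof -
    have "int m - int k + 1 = int (Suc m - k)" using that by simp
    then show ?thesis by (simp only: pochhammer_of_nat)
  qed
  then show ?thesis
    using that by (simp add: xD_def higher_pderiv_monom mult_monom)
qed

lemma higher_pderiv_eq_0: "degree (p :: int poly) < k \<Longrightarrow> (pderiv ^^ k) p = 0"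
  by (rule poly_eqI) (simp add: coeff_higher_pderiv coeff_eq_0)

lemma xD_same_monom_eq_0: "m < k \<Longrightarrow> xD k k (monom 1 m) = 0"
  by (simp add: xD_def higher_pderiv_eq_0 degree_monom_eq)

lemma smult_sum_right: "smult c (\<Sum>x\<in>A. f x) = (\<Sum>x\<in>A. smult c (f x))"
  by (induction A rule: infinite_finite_induct) (simp_all add: smult_add_right)

text \<open>The operators \<open>x\<^sup>k \<partial>\<^sup>k\<close> are linearly independent.\<close>

lemma xD_same_independent:
  assumes fin: "finite {k. S k \<noteq> 0}" "finite {k. T k \<noteq> 0}"
    and eq: "\<And>p. (\<Sum>k | S k \<noteq> 0. smult (S k) (xD k k p)) = (\<Sum>k | T k \<noteq> 0. smult (T k) (xD k k p))"
  shows "S = T"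
proof (rule ext)
  fix m
  show "S m = T m"
  proof (induction m rule: less_induct)
    case (less m)
    have red: "coeff (\<Sum>k | S k \<noteq> 0. smult (S k) (xD k k (monom 1 m))) m =
        (\<Sum>k\<le>m. S k * coeff (xD k k (monom 1 m)) m)" if "finite {k. S k \<noteq> 0}" for S
      unfolding coeff_sum coeff_smult
      by (rule sum.mono_neutral_cong) (use that in \<open>auto simp: xD_same_monom_eq_0 not_le\<close>)
    have "(\<Sum>k\<le>m. S k * coeff (xD k k (monom 1 m)) m) = (\<Sum>k\<le>m. T k * coeff (xD k k (monom 1 m)) m)"
      using red[OF fin(1)] red[OF fin(2)] eq by simp
    moreover have "(\<Sum>k<m. S k * coeff (xD k k (monom 1 m)) m) = (\<Sum>k<m. T k * coeff (xD k k (monom 1 m)) m)"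
      using less by simp
    ultimately have "S m * coeff (xD m m (monom 1 m)) m = T m * coeff (xD m m (monom 1 m)) m"
      by (simp flip: lessThan_Suc_atMost)
    moreover have "coeff (xD m m (monom 1 m)) m \<noteq> 0"
      by (simp add: coeff_xD_same pochhammer_pos)
    ultimately show ?case by simp
  qed
qed

lemma higher_pderiv_monom_mult:
  "\<exists>a. \<forall>g :: int poly. (pderiv ^^ d) (monom 1 m * g) =
     (\<Sum>j\<le>min d m. smult (a j) (monom 1 (m - j) * (pderiv ^^ (d - j)) g))"
proof (induction d arbitrary: m)
  case 0
  show ?case by (rule exI[of _ "\<lambda>_. 1"]) simp
next
  case (Suc d)
  obtain a where a: "\<And>g :: int poly. (pderiv ^^ d) (monom 1 m * g) =
     (\<Sum>j\<le>min d m. smult (a j) (monom 1 (m - j) * (pderiv ^^ (d - j)) g))" using Suc by blast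
  obtain b where b: "\<And>g :: int poly. (pderiv ^^ d) (monom 1 (m - 1) * g) =
     (\<Sum>j\<le>min d (m - 1). smult (b j) (monom 1 (m - 1 - j) * (pderiv ^^ (d - j)) g))" using Suc by blast
  let ?c = "\<lambda>j. (if j \<le> min d m then a j else 0) + (if 0 < j then int m * b (j - 1) else 0)"
  show ?case
  proof (intro exI[of _ ?c] allI)
    fix g :: "int poly"
    let ?M = "\<lambda>j. monom 1 (m - j) * (pderiv ^^ (Suc d - j)) g"
    have "(pderiv ^^ Suc d) (monom 1 m * g) = (pderiv ^^ d) (monom 1 m * pderiv g)
        + smult (int m) ((pderiv ^^ d) (monom 1 (m - 1) * g))"
    proof -
      have "pderiv (monom 1 m * g) = monom 1 m * pderiv g + smult (int m) (monom 1 (m - 1) * g)"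
        by (simp add: pderiv_mult pderiv_monom mult.commute flip: smult_monom[of "int m" 1, simplified])
      then show ?thesis
        by (simp only: funpow_Suc_right o_apply higher_pderiv_add higher_pderiv_smult)
    qed
    also have "(pderiv ^^ d) (monom 1 m * pderiv g) = (\<Sum>j\<le>min d m. smult (a j) (?M j))"
      unfolding a
      by (rule sum.cong) (simp_all add: Suc_diff_le funpow_Suc_right del: funpow.simps)
    also have "\<dots> = (\<Sum>j\<le>min (Suc d) m. smult (if j \<le> min d m then a j else 0) (?M j))"
      by (rule sum.mono_neutral_cong_left) auto
    also have "smult (int m) ((pderiv ^^ d) (monom 1 (m - 1) * g)) =
        (\<Sum>j\<le>min (Suc d) m. smult (if 0 < j then int m * b (j - 1) else 0) (?M j))"
    proof (cases m)
      case (Suc m')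
      then show ?thesis
        unfolding b by (simp add: sum.atMost_Suc_shift smult_sum_right del: sum.atMost_Suc)
    qed simp
    finally show "(pderiv ^^ Suc d) (monom 1 m * g) = (\<Sum>j\<le>min (Suc d) m. smult (?c j) (?M j))"
      by (simp add: smult_add_left sum.distrib)
  qed
qed

lemma ex_gen_stirling:
  assumes "d \<le> q"
  shows "\<exists>S. is_gen_stirling q d n S"
proof -
  have "\<exists>S N. \<forall>p. (xD q d ^^ n) p = monom 1 ((q - d) * n) * (\<Sum>k\<le>N. smult (S k) (xD k k p))"
  proof (induction n)
    case 0
    show ?case
      by (rule exI[of _ "\<lambda>_. 1"], rule exI[of _ 0]) (simp add: xD_def)
  next
    case (Suc n)
    then obtain S N where S: "\<And>p. (xD q d ^^ n) p =
        monom 1 ((q - d) * n) * (\<Sum>k\<le>N. smult (S k) (xD k k p))" by blast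
    let ?e = "(q - d) * n"
    have "\<forall>k. \<exists>a. \<forall>g :: int poly. (pderiv ^^ d) (monom 1 (?e + k) * g) =
       (\<Sum>j\<le>min d (?e + k). smult (a j) (monom 1 (?e + k - j) * (pderiv ^^ (d - j)) g))"
      by (intro allI higher_pderiv_monom_mult)
    from choice[OF this] obtain a where a: "\<And>k g. ((pderiv :: int poly \<Rightarrow> _) ^^ d) (monom 1 (?e + k) * g) =
       (\<Sum>j\<le>min d (?e + k). smult (a k j) (monom 1 (?e + k - j) * (pderiv ^^ (d - j)) g))"
      by blast
    have trm: "xD q d (monom 1 ?e * xD k k p) = monom 1 ((q - d) * Suc n) *
        (\<Sum>j\<le>min d (?e + k). smult (a k j) (xD (k + d - j) (k + d - j) p))" for k p
    proof -
      have "xD q d (monom 1 ?e * xD k k p) = (\<Sum>j\<le>min d (?e + k). smult (a k j)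
          (monom 1 q * (monom 1 (?e + k - j) * (pderiv ^^ (d - j)) ((pderiv ^^ k) p))))"
        by (simp add: xD_def mult.assoc[symmetric] mult_monom a sum_distrib_left)
      also have "\<dots> = (\<Sum>j\<le>min d (?e + k). monom 1 ((q - d) * Suc n) *
          smult (a k j) (xD (k + d - j) (k + d - j) p))"
      proof (rule sum.cong)
        fix j assume "j \<in> {..min d (?e + k)}"
        then have j: "j \<le> d" "j \<le> ?e + k" by auto
        have *: "q + (?e + k - j) = (q - d) * Suc n + (k + d - j)" using j assms by simp
        have "(pderiv ^^ (d - j)) ((pderiv ^^ k) p) = (pderiv ^^ (k + d - j)) p"
          using j funpow_add[of "d - j" k "pderiv :: int poly \<Rightarrow> _"] by (simp add: add.commute)
        then show "smult (a k j) (monom 1 q * (monom 1 (?e + k - j) * (pderiv ^^ (d - j)) ((pderiv ^^ k) p)))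
          = monom 1 ((q - d) * Suc n) * smult (a k j) (xD (k + d - j) (k + d - j) p)"
          by (simp add: xD_def mult.assoc[symmetric] mult_monom * del: mult_Suc_right)
      qed simp
      finally show ?thesis by (simp add: sum_distrib_left)
    qed
    let ?I = "SIGMA k:{..N}. {..min d (?e + k)}"
    let ?f = "\<lambda>(k, j). k + d - j"
    let ?T = "\<lambda>i. \<Sum>(k, j)\<in>{z\<in>?I. ?f z = i}. S k * a k j"
    show ?case
    proof (rule exI[of _ ?T], rule exI[of _ "N + d"], rule allI)
      fix p
      have "(xD q d ^^ Suc n) p = (\<Sum>k\<le>N. smult (S k) (xD q d (monom 1 ?e * xD k k p)))"
        by (simp add: S sum_distrib_left xD_sum xD_smult)
      also have "\<dots> = monom 1 ((q - d) * Suc n) *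
          (\<Sum>(k, j)\<in>?I. smult (S k * a k j) (xD (?f (k, j)) (?f (k, j)) p))"
        by (simp add: trm sum_distrib_left smult_sum_right sum.Sigma[symmetric] del: mult_Suc_right)
      also have "(\<Sum>(k, j)\<in>?I. smult (S k * a k j) (xD (?f (k, j)) (?f (k, j)) p)) =
         (\<Sum>i\<le>N + d. \<Sum>z\<in>{z\<in>?I. ?f z = i}. case z of (k, j) \<Rightarrow>
            smult (S k * a k j) (xD (?f (k, j)) (?f (k, j)) p))"
        by (rule sum.group[symmetric]) auto
      also have "\<dots> = (\<Sum>i\<le>N + d. smult (?T i) (xD i i p))"
        unfolding smult_sum by (intro sum.cong) (auto simp: smult_sum)
      finally show "(xD q d ^^ Suc n) p = monom 1 ((q - d) * Suc n) * (\<Sum>i\<le>N + d. smult (?T i) (xD i i p))" .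
    qed
  qed
  then obtain S N where S: "\<And>p. (xD q d ^^ n) p =
      monom 1 ((q - d) * n) * (\<Sum>k\<le>N. smult (S k) (xD k k p))" by blast
  let ?S = "\<lambda>k. if k \<le> N then S k else 0"
  have fin: "finite {k. ?S k \<noteq> 0}" by (rule finite_subset[of _ "{..N}"]) auto
  have *: "(\<Sum>k\<le>N. smult (S k) (xD k k p)) = (\<Sum>k | ?S k \<noteq> 0. smult (?S k) (xD k k p))" for p
    by (rule sum.mono_neutral_cong_right) auto
  have "is_gen_stirling q d n ?S"
    unfolding is_gen_stirling_def using fin by (simp only: S * simp_thms)
  then show ?thesis by blast
qed

lemma gen_stirling_unique:
  assumes "is_gen_stirling q d n S" "is_gen_stirling q d n T"
  shows "S = T"
  by (rule xD_same_independent) (use assms in \<open>auto simp: is_gen_stirling_def\<close>)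

lemma is_gen_stirling_gen_stirling:
  assumes "d \<le> q"
  shows "is_gen_stirling q d n (gen_stirling q d n)"
proof -
  obtain S where S: "is_gen_stirling q d n S" using ex_gen_stirling[OF assms] ..
  then show ?thesis unfolding gen_stirling_def by (rule theI[of "is_gen_stirling q d n"]) (rule gen_stirling_unique[OF _ S])
qed

section \<open>The ring \<open>R\<langle>t\<rangle>\<close>\<close>

text \<open>The free product of the free commutative monoid on the letters \<open>y\<^sub>i\<close> (\<open>i \<ge> 0\<close>)
  with the free monoid on \<open>t\<close>, in normal form: \<^term>\<open>Yw a\<close> is the commutative monomial
  \<open>y\<^sup>a\<close> and \<^term>\<open>Tw a w\<close> is the word \<open>y\<^sup>a t w\<close>. The monoid is written additively because
  the exponents of a \<^type>\<open>poly_mapping\<close> are; it is not commutative.\<close>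

datatype yword = Yw "nat multiset" | Tw "nat multiset" yword

instantiation yword :: monoid_add
begin

definition zero_yword :: yword where
  "zero_yword = Yw {#}"

fun plus_yword :: "yword \<Rightarrow> yword \<Rightarrow> yword" where
  "Yw a + Yw b = Yw (a + b)"
| "Yw a + Tw b w = Tw (a + b) w"
| "Tw a v + w = Tw a (v + w)"

instance
proof
  fix u v w :: yword
  show "u + v + w = u + (v + w)"
  proof (induction u)
    case (Yw a)
    then show ?case by (cases v; cases w) (simp_all add: add.assoc)
  qed simp
  show "0 + u = u" by (cases u) (simp_all add: zero_yword_def)
  show "u + 0 = u" by (induction u) (simp_all add: zero_yword_def)
qed

end

text \<open>\<open>R\<langle>t\<rangle>\<close> is the monoid ring over \<open>\<int>\<close>; its universal property is \<open>Rt_universal\<close> below.\<close>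

type_synonym Rt = "yword \<Rightarrow>\<^sub>0 int"

definition yv :: "nat \<Rightarrow> Rt" where
  "yv i = frag_of (Yw {#i#})"

definition tv :: Rt where
  "tv = frag_of (Tw {#} (Yw {#}))"

lemma frag_of_mult: "frag_of v * frag_of w = frag_of (v + w :: yword)"
  by (simp add: mult_single)

lemma one_Rt: "(1 :: Rt) = frag_of (Yw {#})"
  by (simp add: zero_yword_def flip: single_one)

lemma frag_of_Yw_add_mset: "frag_of (Yw (add_mset i a)) = yv i * frag_of (Yw a)"
  by (simp add: yv_def frag_of_mult)

lemma frag_of_Tw: "frag_of (Tw a w) = frag_of (Yw a) * (tv * frag_of w)"
  by (cases w) (simp_all add: tv_def frag_of_mult)

lemma Yw_empty_add [simp]: "Yw {#} + w = w"
  by (simp flip: zero_yword_def)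

lemma of_int_mult_Rt: "of_int x * p = frag_cmul x (p :: Rt)"
  by (induction x rule: int_induct[of _ 0])
    (simp_all add: frag_cmul_distrib frag_cmul_diff_distrib distrib_right left_diff_distrib)

lemma yv_commute: "yv i * yv j = yv j * yv i"
  by (simp add: yv_def frag_of_mult add_mset_commute)

primrec eval_word :: "(nat \<Rightarrow> 'b :: ring_1) \<Rightarrow> 'b \<Rightarrow> yword \<Rightarrow> 'b" where
  "eval_word z s (Yw a) = fold_mset (\<lambda>i r. z i * r) 1 a"
| "eval_word z s (Tw a w) = fold_mset (\<lambda>i r. z i * r) 1 a * s * eval_word z s w"

lemma eval_word_add:
  assumes "\<And>i j. z i * z j = z j * z i"
  shows "eval_word z s (v + w) = eval_word z s v * eval_word z s w"
proof -
  interpret comp_fun_commute "\<lambda>i r. z i * r"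
    by standard (simp add: fun_eq_iff assms flip: mult.assoc)
  have "fold_mset (\<lambda>i r. z i * r) 1 (a + b) =
      fold_mset (\<lambda>i r. z i * r) 1 a * fold_mset (\<lambda>i r. z i * r) 1 b" for a b
    by (induction a) (simp_all add: mult.assoc)
  then show ?thesis
    by (induction v w rule: plus_yword.induct) (simp_all add: mult.assoc)
qed

lemma additive_diff:
  fixes h :: "'a :: ab_group_add \<Rightarrow> 'b :: ab_group_add"
  assumes "\<And>p q. h (p + q) = h p + h q"
  shows "h (p - q) = h p - h q" "h 0 = 0"
proof -
  show "h (p - q) = h p - h q" using assms[of "p - q" q] by simp
  show "h 0 = 0" using assms[of 0 0] by simp
qed

lemma additive_Rt_eqI:
  fixes h h' :: "Rt \<Rightarrow> 'b :: ab_group_add"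
  assumes "\<And>p q. h (p + q) = h p + h q" "\<And>p q. h' (p + q) = h' p + h' q"
    and "\<And>w. h (frag_of w) = h' (frag_of w)"
  shows "h p = h' p"
proof (rule frag_induction[of p UNIV])
  show "h 0 = h' 0"
    by (simp add: additive_diff(2)[of h, OF assms(1)] additive_diff(2)[of h', OF assms(2)])
  show "h (a - b) = h' (a - b)" if "h a = h' a" "h b = h' b" for a b
    using that by (simp add: additive_diff(1)[of h, OF assms(1)] additive_diff(1)[of h', OF assms(2)])
qed (simp_all add: assms(3))

lemma Rt_universal:
  fixes z :: "nat \<Rightarrow> 'b :: ring_1" and s :: 'b
  assumes z: "\<And>i j. z i * z j = z j * z i"
  shows "\<exists>!h :: Rt \<Rightarrow> 'b. (\<forall>p q. h (p + q) = h p + h q) \<and> (\<forall>p q. h (p * q) = h p * h q) \<and>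
    h 1 = 1 \<and> (\<forall>i. h (yv i) = z i) \<and> h tv = s" (is "\<exists>!h. ?P h")
proof (rule ex_ex1I)
  interpret comp_fun_commute "\<lambda>i r. z i * r"
    by standard (simp add: fun_eq_iff z flip: mult.assoc)
  define h where "h p = (\<Sum>w\<in>Poly_Mapping.keys p. of_int (Poly_Mapping.lookup p w) * eval_word z s w)" for p
  have h_super: "h p = (\<Sum>w\<in>A. of_int (Poly_Mapping.lookup p w) * eval_word z s w)"
    if "finite A" "Poly_Mapping.keys p \<subseteq> A" for p A
    unfolding h_def by (rule sum.mono_neutral_left) (use that in \<open>auto simp: in_keys_iff\<close>)
  have add: "h (p + q) = h p + h q" for p q
  proof -
    let ?A = "Poly_Mapping.keys p \<union> Poly_Mapping.keys q"
    have "h (p + q) = (\<Sum>w\<in>?A. of_int (Poly_Mapping.lookup (p + q) w) * eval_word z s w)"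
      by (rule h_super) (simp_all add: keys_add)
    then show ?thesis
      by (simp add: h_super[of ?A p] h_super[of ?A q] lookup_add distrib_right sum.distrib)
  qed
  have of: "h (frag_of w) = eval_word z s w" for w
    by (simp add: h_def)
  have mult: "h (p * q) = h p * h q" for p q
  proof (rule additive_Rt_eqI[of "\<lambda>p. h (p * q)" "\<lambda>p. h p * h q"])
    fix v
    show "h (frag_of v * q) = h (frag_of v) * h q"
      by (rule additive_Rt_eqI[of "\<lambda>q. h (frag_of v * q)" "\<lambda>q. h (frag_of v) * h q"])
        (simp_all add: add of frag_of_mult eval_word_add[OF z] distrib_left)
  qed (simp_all add: add distrib_right)
  have "?P h"
    by (simp add: add mult of one_Rt yv_def tv_def)
  then show "\<exists>h. ?P h" by blast
next
  fix h h' :: "Rt \<Rightarrow> 'b"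
  assume h: "?P h" and h': "?P h'"
  have Y: "h (frag_of (Yw a)) = h' (frag_of (Yw a))" for a
    using h h' by (induction a) (simp_all add: frag_of_Yw_add_mset flip: one_Rt)
  have W: "h (frag_of w) = h' (frag_of w)" for w
    using h h' by (induction w) (simp_all add: Y frag_of_Tw)
  show "h = h'"
  proof
    fix p show "h p = h' p"
      by (rule additive_Rt_eqI) (use h h' W in simp_all)
  qed
qed

section \<open>The derivation and the coefficients\<close>

primrec Delta_word :: "yword \<Rightarrow> Rt" where
  "Delta_word (Yw a) = (\<Sum>i\<in>#a. frag_of (Yw (add_mset (Suc i) (a - {#i#}))))"
| "Delta_word (Tw a w) = (\<Sum>i\<in>#a. frag_of (Tw (add_mset (Suc i) (a - {#i#})) w)) +
     frag_of (Tw a (Yw {#})) * Delta_word w"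

definition Delta :: "Rt \<Rightarrow> Rt" where
  "Delta = frag_extend Delta_word"

lemma Delta_add: "Delta (p + q) = Delta p + Delta q"
  by (simp add: Delta_def frag_extend_add)

lemma Delta_frag_of: "Delta (frag_of w) = Delta_word w"
  by (simp add: Delta_def)

lemma Delta_yv: "Delta (yv i) = yv (Suc i)"
  by (simp add: Delta_frag_of yv_def)

lemma Delta_tv: "Delta tv = 0"
  by (simp add: Delta_frag_of tv_def)

lemma sum_mset_Suc_union:
  fixes f :: "nat multiset \<Rightarrow> 'b :: comm_monoid_add"
  shows "(\<Sum>i\<in>#a. f (add_mset (Suc i) (a + b - {#i#}))) = (\<Sum>i\<in>#a. f (add_mset (Suc i) (a - {#i#}) + b))"
    and "(\<Sum>i\<in>#b. f (add_mset (Suc i) (a + b - {#i#}))) = (\<Sum>i\<in>#b. f (a + add_mset (Suc i) (b - {#i#})))"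
  by (rule arg_cong[of _ _ sum_mset], rule image_mset_cong, auto dest!: multi_member_split)+

lemma Rt_sum_mset_distrib:
  fixes f :: "nat \<Rightarrow> Rt"
  shows "p * (\<Sum>i\<in>#a. f i) = (\<Sum>i\<in>#a. p * f i)" "(\<Sum>i\<in>#a. f i) * p = (\<Sum>i\<in>#a. f i * p)"
  by (induction a) (simp_all add: distrib_left distrib_right)

lemma Delta_word_add: "Delta_word (v + w) = Delta_word v * frag_of w + frag_of v * Delta_word w"
proof (induction v w rule: plus_yword.induct)
  case (1 a b)
  then show ?case
    by (simp add: sum_mset_Suc_union[of "\<lambda>m. frag_of (Yw m)"] Rt_sum_mset_distrib frag_of_mult
        del: union_mset_add_mset_left union_mset_add_mset_right)
next
  case (2 a b w)
  then show ?case
    by (simp add: sum_mset_Suc_union[of "\<lambda>m. frag_of (Tw m w)"] Rt_sum_mset_distrib frag_of_mult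
        distrib_left add.assoc flip: mult.assoc del: union_mset_add_mset_left union_mset_add_mset_right)
next
  case (3 a v w)
  then show ?case
    by (simp add: Rt_sum_mset_distrib frag_of_mult distrib_left distrib_right add.assoc flip: mult.assoc)
qed

lemma Delta_mult: "Delta (p * q) = Delta p * q + p * Delta q"
proof (rule additive_Rt_eqI[of "\<lambda>p. Delta (p * q)" "\<lambda>p. Delta p * q + p * Delta q"])
  fix v
  show "Delta (frag_of v * q) = Delta (frag_of v) * q + frag_of v * Delta q"
    by (rule additive_Rt_eqI[of "\<lambda>q. Delta (frag_of v * q)"
          "\<lambda>q. Delta (frag_of v) * q + frag_of v * Delta q"])
      (simp_all add: Delta_add Delta_frag_of frag_of_mult Delta_word_add distrib_left ac_simps)
qed (simp_all add: Delta_add distrib_right distrib_left ac_simps)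

lemma Delta_unique:
  assumes add: "\<And>p q. D (p + q) = D p + D q" and mult: "\<And>p q. D (p * q) = D p * q + p * D q"
    and y: "\<And>i. D (yv i) = yv (Suc i)" and t: "D tv = (0 :: Rt)"
  shows "D = Delta"
proof
  fix p
  have one: "D 1 = 0" if "\<And>p q. D (p * q) = D p * q + p * D q" for D :: "Rt \<Rightarrow> Rt"
    using that[of 1 1] by simp
  have Y: "D (frag_of (Yw a)) = Delta (frag_of (Yw a))" for a
    by (induction a)
      (simp_all only: frag_of_Yw_add_mset mult y Delta_mult Delta_yv one[OF mult] one[OF Delta_mult]
        flip: one_Rt)
  have "D (frag_of w) = Delta (frag_of w)" for w
    by (induction w) (simp_all only: Y frag_of_Tw mult Delta_mult t Delta_tv)
  then show "D p = Delta p"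
    by (rule additive_Rt_eqI[of D Delta, OF add Delta_add])
qed

primrec U_poly :: "nat \<Rightarrow> nat \<Rightarrow> Rt" where
  "U_poly 0 d = 1"
| "U_poly (Suc n) d = yv 0 * ((\<lambda>p. Delta p + p * tv) ^^ d) (U_poly n d)"

text \<open>The word \<open>y\<^sup>a t\<^sup>k\<close>.\<close>

primrec ytw :: "nat \<Rightarrow> nat multiset \<Rightarrow> yword" where
  "ytw 0 a = Yw a"
| "ytw (Suc k) a = Tw a (ytw k {#})"

text \<open>The coefficient of \<open>y\<^sub>0\<close> to the power \<open>n - size l\<close> times \<open>y\<^sub>l t\<^sup>k\<close> in \<open>U_poly n d\<close>, where
  \<open>k = n * d - sum_mset l\<close>. Distinct pairs \<open>(l, k)\<close> give distinct words because \<open>l\<close> has no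
  zero parts; the defining expansion is \<open>U_poly_expansion\<close> below.\<close>

definition c_coeff :: "nat \<Rightarrow> nat \<Rightarrow> nat multiset \<Rightarrow> int" where
  "c_coeff n d l =
     (if is_partition l \<and> sum_mset l \<le> (n - 1) * d \<and> size l \<le> n - 1
      then Poly_Mapping.lookup (U_poly n d) (ytw (n * d - sum_mset l) (replicate_mset (n - size l) 0 + l))
      else 0)"

lemma ytw_eq_iff [simp]: "ytw k a = ytw j b \<longleftrightarrow> k = j \<and> a = b"
proof (induction k arbitrary: j a b)
  case 0
  show ?case by (cases j) auto
next
  case (Suc k)
  show ?case using Suc by (cases j) auto
qed

lemma Yw_add_ytw: "Yw a + ytw k b = ytw k (a + b)"
  by (cases k) simp_all

lemma ytw_add_t: "ytw k a + Tw {#} (Yw {#}) = ytw (Suc k) a"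
  by (induction k arbitrary: a) simp_all

lemma frag_of_ytw:
  "frag_of (ytw k (replicate_mset m 0 + a)) = yv 0 ^ m * frag_of (Yw a) * tv ^ k"
proof -
  have "frag_of (Yw a) * tv ^ k = frag_of (ytw k a)"
    by (induction k) (simp_all add: tv_def frag_of_mult ytw_add_t power_Suc2 zero_yword_def flip: mult.assoc del: power_Suc ytw.simps(2))
  moreover have "frag_of (ytw k (add_mset i b)) = yv i * frag_of (ytw k b)" for i b
    by (simp add: yv_def frag_of_mult Yw_add_ytw)
  then have "frag_of (ytw k (replicate_mset m 0 + a)) = yv 0 ^ m * frag_of (ytw k a)"
    by (induction m) (simp_all add: mult.assoc)
  ultimately show ?thesis by (simp add: mult.assoc)
qed

lemma Delta_word_ytw: "Delta_word (ytw k a) = (\<Sum>i\<in>#a. frag_of (ytw k (add_mset (Suc i) (a - {#i#}))))"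
proof -
  have "Delta_word (ytw k {#}) = 0" for k
    by (induction k) simp_all
  then show ?thesis by (cases k) simp_all
qed

lemma keys_sum_mset: "Poly_Mapping.keys (\<Sum>i\<in>#a. f i) \<subseteq> (\<Union>i\<in>set_mset a. Poly_Mapping.keys (f i :: Rt))"
proof (induction a)
  case (add i a)
  then show ?case using keys_add[of "f i" "\<Sum>i\<in>#a. f i"] by auto
qed simp

lemma keys_U_poly:
  assumes "w \<in> Poly_Mapping.keys (U_poly n d)"
  shows "\<exists>k a. w = ytw k a \<and> size a = n \<and> sum_mset a + k = n * d \<and> (0 < n \<longrightarrow> d \<le> k \<and> 0 \<in># a)"
  using assms
proof (induction n arbitrary: w)
  case 0
  then show ?case
    by (intro exI[of _ 0] exI[of _ "{#}"]) (simp add: one_Rt)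
next
  case (Suc n)
  define F where "F = (\<lambda>p. Delta p + p * tv)"
  have step: "\<exists>k a. w = ytw k a \<and> size a = n \<and> sum_mset a + k = n * d + j \<and> (0 < n \<longrightarrow> d \<le> k)"
    if "w \<in> Poly_Mapping.keys ((F ^^ j) (U_poly n d))" for w j
    using that
  proof (induction j arbitrary: w)
    case 0
    then show ?case using Suc.IH by fastforce
  next
    case (Suc j)
    let ?p = "(F ^^ j) (U_poly n d)"
    from Suc.prems consider "w \<in> Poly_Mapping.keys (Delta ?p)" | "w \<in> Poly_Mapping.keys (?p * tv)"
      using keys_add[of "Delta ?p" "?p * tv"] by (auto simp: F_def)
    then show ?case
    proof cases
      case 1
      then obtain v where v: "v \<in> Poly_Mapping.keys ?p" "w \<in> Poly_Mapping.keys (Delta_word v)"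
        using keys_frag_extend[of Delta_word ?p] by (auto simp: Delta_def)
      from Suc.IH[OF v(1)] obtain k a where a: "v = ytw k a" "size a = n" "sum_mset a + k = n * d + j" "0 < n \<longrightarrow> d \<le> k"
        by (elim exE conjE) (rule that)
      from v(2) obtain i where i: "i \<in># a" "w = ytw k (add_mset (Suc i) (a - {#i#}))"
        using keys_sum_mset[of "\<lambda>i. frag_of (ytw k (add_mset (Suc i) (a - {#i#})))" a]
        by (auto simp: a(1) Delta_word_ytw)
      from i(1) obtain b where b: "a = add_mset i b" by (auto dest: multi_member_split)
      show ?thesis
        by (rule exI[of _ k], rule exI[of _ "add_mset (Suc i) b"]) (use a i b in simp)
    next
      case 2
      then obtain v where v: "v \<in> Poly_Mapping.keys ?p" "w = v + Tw {#} (Yw {#})"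
        using keys_mult[of ?p tv] by (auto simp: tv_def)
      from Suc.IH[OF v(1)] obtain k a where a: "v = ytw k a" "size a = n" "sum_mset a + k = n * d + j" "0 < n \<longrightarrow> d \<le> k"
        by (elim exE conjE) (rule that)
      show ?thesis
        by (rule exI[of _ "Suc k"], rule exI[of _ a]) (use a v(2) in \<open>auto simp: ytw_add_t simp del: ytw.simps\<close>)
    qed
  qed
  from Suc.prems obtain v where v: "v \<in> Poly_Mapping.keys ((F ^^ d) (U_poly n d))" "w = Yw {#0#} + v"
    using keys_mult[of "yv 0" "(F ^^ d) (U_poly n d)"] by (auto simp: yv_def F_def)
  from step[OF v(1)] obtain k a where a: "v = ytw k a" "size a = n" "sum_mset a + k = n * d + d" "0 < n \<longrightarrow> d \<le> k"
    by (elim exE conjE) (rule that)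
  have "d \<le> k"
    using a by (cases "n = 0") auto
  show ?case
    by (rule exI[of _ k], rule exI[of _ "add_mset 0 a"]) (use a v(2) \<open>d \<le> k\<close> in \<open>simp add: Yw_add_ytw\<close>)
qed

lemma multiset_split_zeros: "a = replicate_mset (count a 0) 0 + filter_mset (\<lambda>i. i \<noteq> 0) (a :: nat multiset)"
  by (rule multiset_eqI) simp

lemma filter_replicate_mset_zero: "filter_mset (\<lambda>i. i > 0) (replicate_mset j (0 :: nat)) = {#}"
  by (simp add: multiset_eq_iff)

lemma replicate_zeros_eq:
  assumes "is_partition l" "is_partition m" "replicate_mset i 0 + l = replicate_mset j 0 + m"
  shows "l = m"
proof -
  have "filter_mset (\<lambda>i. i \<noteq> 0) (replicate_mset i 0 + l) = filter_mset (\<lambda>i. i \<noteq> 0) (replicate_mset j 0 + m)"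
    using assms(3) by simp
  moreover have "filter_mset (\<lambda>i. i \<noteq> 0) l = l" "filter_mset (\<lambda>i. i \<noteq> 0) m = m"
    using assms(1,2) by (auto simp: is_partition_def filter_mset_eq_conv intro!: gr0I)
  ultimately show ?thesis by (simp add: filter_replicate_mset_zero)
qed

lemma U_poly_expansion:
  assumes "1 \<le> n" "1 \<le> d"
  shows "U_poly n d = (\<Sum>k = d..n * d. \<Sum>l | is_partition l \<and> sum_mset l = n * d - k \<and> size l \<le> n - 1.
    of_int (c_coeff n d l) * yv 0 ^ (n - size l) * frag_of (Yw l) * tv ^ k)"
proof -
  let ?L = "\<lambda>k. {l. is_partition l \<and> sum_mset l = n * d - k \<and> size l \<le> n - 1}"
  let ?w = "\<lambda>k l. ytw k (replicate_mset (n - size l) 0 + l)"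
  have fin: "finite (?L k)" for k
    by (rule finite_subset[OF _ finite_partitions[of "n * d"]]) auto
  have nd: "(n - Suc 0) * d = n * d - d" by (simp add: diff_mult_distrib)
  have c: "c_coeff n d l = Poly_Mapping.lookup (U_poly n d) (?w k l)"
    if "k \<in> {d..n * d}" "l \<in> ?L k" for k l
    using that by (auto simp: c_coeff_def nd)
  have mono: "of_int x * yv 0 ^ (n - size l) * frag_of (Yw l) * tv ^ k = frag_cmul x (frag_of (?w k l))" for x k l
    by (simp only: frag_of_ytw mult.assoc of_int_mult_Rt[symmetric])
  have "U_poly n d = (\<Sum>(k, l)\<in>Sigma {d..n * d} ?L.
      frag_cmul (Poly_Mapping.lookup (U_poly n d) (?w k l)) (frag_of (?w k l)))"
  proof -
    let ?f = "\<lambda>(k, l). ?w k l"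
    have inj: "inj_on ?f (Sigma {d..n * d} ?L)"
    proof (rule inj_onI, clarify)
      fix k l j m
      assume part: "is_partition l" "is_partition m" and eq: "?w k l = ?w j m"
      from eq have "k = j" and "replicate_mset (n - size l) 0 + l = replicate_mset (n - size m) 0 + m"
        by simp_all
      then show "k = j \<and> l = m" using replicate_zeros_eq[OF part] by simp
    qed
    have "U_poly n d = (\<Sum>w\<in>Poly_Mapping.keys (U_poly n d).
        frag_cmul (Poly_Mapping.lookup (U_poly n d) w) (frag_of w))"
      by (rule frag_expansion[unfolded frag_extend_def])
    also have "\<dots> = (\<Sum>w\<in>?f ` Sigma {d..n * d} ?L.
        frag_cmul (Poly_Mapping.lookup (U_poly n d) w) (frag_of w))"
    proof (rule sum.mono_neutral_left)
      show "finite (?f ` Sigma {d..n * d} ?L)"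
        by (intro finite_imageI finite_SigmaI fin) simp
      show "Poly_Mapping.keys (U_poly n d) \<subseteq> ?f ` Sigma {d..n * d} ?L"
      proof
        fix w assume "w \<in> Poly_Mapping.keys (U_poly n d)"
        from keys_U_poly[OF this] assms obtain k a where a: "w = ytw k a" "size a = n"
          "sum_mset a + k = n * d" "d \<le> k" "0 \<in># a" by auto
        let ?l = "filter_mset (\<lambda>i. i \<noteq> 0) a"
        note split = multiset_split_zeros[of a]
        have size: "size a = count a 0 + size ?l" by (rule arg_cong[OF split, THEN trans]) simp
        have sum: "sum_mset a = sum_mset ?l" by (rule arg_cong[OF split, THEN trans]) simp
        have "0 < count a 0" using a(5) by simp
        then have "size ?l \<le> n - 1" using a(2) size by linarith
        then have "?l \<in> ?L k" "k \<in> {d..n * d}"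
          using a(3,4) sum by (auto simp: is_partition_def)
        moreover have "w = ?f (k, ?l)"
        proof -
          have "n - size ?l = count a 0" using a(2) size by simp
          then show ?thesis using a(1) split by (simp only: prod.case)
        qed
        ultimately show "w \<in> ?f ` Sigma {d..n * d} ?L" by blast
      qed
      show "\<forall>w\<in>?f ` Sigma {d..n * d} ?L - Poly_Mapping.keys (U_poly n d).
          frag_cmul (Poly_Mapping.lookup (U_poly n d) w) (frag_of w) = 0"
        by (auto simp: in_keys_iff)
    qed
    also have "\<dots> = (\<Sum>(k, l)\<in>Sigma {d..n * d} ?L.
      frag_cmul (Poly_Mapping.lookup (U_poly n d) (?w k l)) (frag_of (?w k l)))"
      by (subst sum.reindex[OF inj]) (simp add: case_prod_unfold)
    finally show ?thesis .
  qed
  also have "\<dots> = (\<Sum>k = d..n * d. \<Sum>l\<in>?L k.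
      frag_cmul (Poly_Mapping.lookup (U_poly n d) (?w k l)) (frag_of (?w k l)))"
    using fin by (simp add: sum.Sigma)
  also have "\<dots> = (\<Sum>k = d..n * d. \<Sum>l\<in>?L k.
      of_int (c_coeff n d l) * yv 0 ^ (n - size l) * frag_of (Yw l) * tv ^ k)"
    unfolding mono by (intro sum.cong refl) (simp only: c)
  finally show ?thesis .
qed

end

theory Submission
  imports Defs
begin

text \<open>The noncommutative ring acts on polynomials: fix \<open>f\<close> in \<open>\<int>[x]\<close>, let \<open>y\<^sub>i\<close> act as
  multiplication by the \<open>i\<close>-th derivative of \<open>f\<close>, and let \<open>t\<close> act as \<open>\<partial>\<close>. The commutator with
  \<open>\<partial>\<close> is then a derivation of operators that sends \<open>y\<^sub>i\<close> to \<open>y\<^bsub>i+1\<^esub>\<close> and \<open>t\<close> to \<open>0\<close>, just as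
  \<open>\<Delta>\<close> does in the ring itself. Hence \<open>\<Delta> P\<close> acts as \<open>\<partial> P - P \<partial>\<close>, and \<open>\<Delta> P + P t\<close> acts as
  \<open>\<partial> P\<close> (\<open>operator_Delta_plus_tv\<close>). The recursion for \<open>U\<^bsub>n,d\<^esub>\<close> therefore becomes left
  composition with \<open>f \<partial>\<^sup>d\<close>, and \<open>U\<^bsub>n,d\<^esub>\<close> acts as \<open>(f \<partial>\<^sup>d)\<^sup>n\<close> (\<open>operator_U_poly\<close>).

  For \<open>f = x\<^sup>q\<close> the \<open>i\<close>-th derivative is a falling factorial times \<open>x\<^bsup>q-i\<^esup>\<close>, so the term of
  the expansion of \<open>U\<^bsub>n,d\<^esub>\<close> that belongs to \<open>\<lambda>\<close> and \<open>k\<close> acts as a product of falling factorials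
  times \<open>x\<^bsup>qn-|\<lambda>|\<^esup> \<partial>\<^sup>k\<close> (\<open>partition_term_monom\<close>). As \<open>|\<lambda>| = nd - k\<close>, the exponent of \<open>x\<close>
  is \<open>(q-d)n + k\<close>: this is an expansion of \<open>(x\<^sup>q \<partial>\<^sup>d)\<^sup>n\<close> of the kind that defines the generalized
  Stirling numbers, and such an expansion is unique.\<close>

section \<open>The action on polynomials\<close>

primrec word_operator :: "int poly \<Rightarrow> yword \<Rightarrow> int poly \<Rightarrow> int poly" where
  "word_operator f (Yw a) p = (\<Prod>i\<in>#a. (pderiv ^^ i) f) * p"
| "word_operator f (Tw a w) p = (\<Prod>i\<in>#a. (pderiv ^^ i) f) * pderiv (word_operator f w p)"

definition operator :: "int poly \<Rightarrow> Rt \<Rightarrow> int poly \<Rightarrow> int poly" where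
  "operator f P p =
     (\<Sum>w\<in>Poly_Mapping.keys P. smult (Poly_Mapping.lookup P w) (word_operator f w p))"

lemma word_operator_add: "word_operator f w (p + r) = word_operator f w p + word_operator f w r"
  by (induction w) (simp_all add: pderiv_add distrib_left)

lemma word_operator_plus: "word_operator f (v + w) p = word_operator f v (word_operator f w p)"
  by (induction v w rule: plus_yword.induct) (simp_all add: mult.assoc)

lemma operator_frag_of [simp]: "operator f (frag_of w) p = word_operator f w p"
  by (simp add: operator_def)

lemma operator_add: "operator f (P + Q) p = operator f P p + operator f Q p"
proof -
  let ?A = "Poly_Mapping.keys P \<union> Poly_Mapping.keys Q"
  have superset: "operator f R p = (\<Sum>w\<in>?A. smult (Poly_Mapping.lookup R w) (word_operator f w p))"
    if "Poly_Mapping.keys R \<subseteq> ?A" for R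
    unfolding operator_def
    by (rule sum.mono_neutral_left) (use that in \<open>auto simp: in_keys_iff\<close>)
  show ?thesis
    by (simp add: superset keys_add lookup_add smult_add_left sum.distrib)
qed

lemma operator_zero [simp]: "operator f 0 p = 0"
  by (simp add: operator_def)

lemma operator_sum_mset: "operator f (\<Sum>i\<in>#a. g i) p = (\<Sum>i\<in>#a. operator f (g i) p)"
  by (induction a) (simp_all add: operator_add)

lemma operator_sum: "operator f (\<Sum>x\<in>A. g x) p = (\<Sum>x\<in>A. operator f (g x) p)"
  by (induction A rule: infinite_finite_induct) (simp_all add: operator_add)

lemma operator_frag_cmul: "operator f (frag_cmul c P) p = smult c (operator f P p)"
proof (cases "c = 0")
  case False
  then have "Poly_Mapping.keys (frag_cmul c P) = Poly_Mapping.keys P"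
    by (auto simp: in_keys_iff)
  then show ?thesis
    by (simp add: operator_def smult_sum_right)
qed simp

lemma operator_word_mult: "operator f (frag_of v * P) p = word_operator f v (operator f P p)"
  by (rule additive_Rt_eqI)
    (simp_all add: distrib_left operator_add word_operator_add frag_of_mult word_operator_plus)

lemma operator_mult_word: "operator f (P * frag_of v) p = operator f P (word_operator f v p)"
  by (rule additive_Rt_eqI)
    (simp_all add: distrib_right operator_add frag_of_mult word_operator_plus)

section \<open>The derivation as a commutator\<close>

lemma pderiv_prod_mset:
  "pderiv (\<Prod>i\<in>#a. g i) = (\<Sum>i\<in>#a. pderiv (g i) * (\<Prod>j\<in>#a - {#i#}. g j))"
  for g :: "'b \<Rightarrow> int poly"
proof (induction a)
  case (add x a)
  have "(\<Sum>i\<in>#a. pderiv (g i) * (\<Prod>j\<in>#add_mset x a - {#i#}. g j)) =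
      (\<Sum>i\<in>#a. g x * (pderiv (g i) * (\<Prod>j\<in>#a - {#i#}. g j)))"
    by (rule arg_cong[of _ _ sum_mset], rule image_mset_cong) (auto dest!: multi_member_split)
  then show ?case
    by (simp add: pderiv_mult add sum_mset_distrib_left mult.commute)
qed simp

text \<open>On words the identity \<open>\<partial> P = \<Delta> P + P \<partial>\<close> is the product rule: the derivative falls either
  on one of the factors \<open>y\<^sub>i\<close>, which raises its index, or on the argument of the operator.\<close>

lemma pderiv_word_operator:
  "pderiv (word_operator f w p) = operator f (Delta_word w) p + word_operator f w (pderiv p)"
proof (induction w)
  case (Yw a)
  show ?case
    by (simp add: pderiv_mult pderiv_prod_mset operator_sum_mset)
      (simp add: sum_mset_distrib_left ac_simps)
next
  case (Tw a w)
  show ?case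
    by (simp add: pderiv_mult pderiv_prod_mset operator_sum_mset operator_add
        operator_word_mult Tw pderiv_add distrib_left)
      (simp add: sum_mset_distrib_left sum_mset.distrib distrib_left ac_simps)
qed

lemma operator_Delta_plus_tv: "operator f (Delta P + P * tv) p = pderiv (operator f P p)"
  by (rule additive_Rt_eqI)
    (simp_all add: Delta_add distrib_right operator_add pderiv_add Delta_frag_of
      pderiv_word_operator tv_def operator_mult_word)

lemma operator_U_poly: "operator f (U_poly n d) p = ((\<lambda>r. f * (pderiv ^^ d) r) ^^ n) p"
proof (induction n)
  case 0
  show ?case by (simp add: one_Rt)
next
  case (Suc n)
  have "operator f (((\<lambda>P. Delta P + P * tv) ^^ j) P) p = (pderiv ^^ j) (operator f P p)" for j P
    by (induction j) (simp_all add: operator_Delta_plus_tv)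
  with Suc show ?case
    by (simp add: yv_def operator_word_mult)
qed

lemma word_operator_ytw: "word_operator f (ytw k a) p = (\<Prod>i\<in>#a. (pderiv ^^ i) f) * (pderiv ^^ k) p"
proof -
  have "word_operator f (ytw k {#}) p = (pderiv ^^ k) p" for k
    by (induction k) simp_all
  then show ?thesis by (cases k) simp_all
qed

text \<open>Normal ordering of \<open>(f \<partial>\<^sup>d)\<^sup>n\<close> for arbitrary \<open>f\<close>, obtained by letting both sides of
  the expansion of \<open>U_poly\<close> act; \<open>y\<^sub>0\<close> acts as multiplication by \<open>f\<close> itself, whence the power
  of \<open>f\<close>.\<close>

lemma power_f_pderiv_expansion:
  assumes "1 \<le> n" "1 \<le> d"
  shows "((\<lambda>r. f * (pderiv ^^ d) r) ^^ n) p =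
    (\<Sum>k = d..n * d. \<Sum>l | is_partition l \<and> sum_mset l = n * d - k \<and> size l \<le> n - 1.
      smult (c_coeff n d l) (f ^ (n - size l) * (\<Prod>i\<in>#l. (pderiv ^^ i) f) * (pderiv ^^ k) p))"
proof -
  have term_image: "of_int c * yv 0 ^ m * frag_of (Yw l) * tv ^ k =
      frag_cmul c (frag_of (ytw k (replicate_mset m 0 + l)))" for c m l k
    by (simp only: frag_of_ytw mult.assoc of_int_mult_Rt[symmetric])
  show ?thesis
    unfolding operator_U_poly[symmetric] U_poly_expansion[OF assms] term_image
    by (simp add: operator_sum operator_frag_cmul word_operator_ytw)
qed

section \<open>Specialization to powers of \<open>x\<close>\<close>

text \<open>The factor \<open>x\<^sup>i\<close> avoids the truncated exponent \<open>q - i\<close>, so that the formula also covers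
  \<open>i > q\<close>, where both sides vanish.\<close>

lemma higher_pderiv_monom_falling:
  "(pderiv ^^ i) (monom 1 q) * monom 1 i = monom (falling_fact (int q) i) q"
proof (induction i)
  case 0
  show ?case by (simp add: falling_fact_def)
next
  case (Suc i)
  let ?g = "(pderiv ^^ i) (monom 1 q) :: int poly" and ?m = "monom 1 i :: int poly"
  have euler: "monom 1 1 * pderiv (monom (c :: int) j) = smult (int j) (monom c j)" for c j
    by (cases j) (simp_all add: pderiv_monom mult_monom smult_monom)
  have "monom 1 (Suc i) = monom 1 1 * ?m"
    by (simp add: mult_monom)
  then have "(pderiv ^^ Suc i) (monom 1 q) * monom 1 (Suc i) =
      monom 1 1 * pderiv (?g * ?m) - ?g * (monom 1 1 * pderiv ?m)"
    by (simp add: pderiv_mult algebra_simps)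
  also have "\<dots> = smult (int q) (monom (falling_fact (int q) i) q) - smult (int i) (?g * ?m)"
    unfolding Suc by (simp only: euler mult_smult_right Suc)
  also have "\<dots> = monom (falling_fact (int q) (Suc i)) q"
    unfolding Suc by (simp add: smult_monom diff_monom falling_fact_def algebra_simps)
  finally show ?case .
qed

lemma prod_higher_pderiv_monom:
  "(\<Prod>i\<in>#l. (pderiv ^^ i) (monom 1 q)) * monom 1 (sum_mset l) =
    monom (\<Prod>i\<in>#l. falling_fact (int q) i) (q * size l)"
proof (induction l)
  case (add i l)
  have "monom 1 (i + sum_mset l) = monom 1 i * monom (1 :: int) (sum_mset l)"
    by (simp add: mult_monom)
  then have "(\<Prod>j\<in>#add_mset i l. (pderiv ^^ j) (monom (1 :: int) q)) * monom 1 (sum_mset (add_mset i l)) =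
      ((pderiv ^^ i) (monom 1 q) * monom 1 i) *
      ((\<Prod>j\<in>#l. (pderiv ^^ j) (monom 1 q)) * monom 1 (sum_mset l))"
    by (simp add: ac_simps)
  also have "\<dots> = monom (\<Prod>j\<in>#add_mset i l. falling_fact (int q) j) (q * size (add_mset i l))"
    by (simp only: add higher_pderiv_monom_falling mult_monom) simp
  finally show ?case .
qed simp

lemma partition_term_monom:
  assumes "d \<le> q" "sum_mset l + k = n * d" "size l \<le> n"
  shows "monom 1 q ^ (n - size l) * (\<Prod>i\<in>#l. (pderiv ^^ i) (monom 1 q)) =
    monom (\<Prod>i\<in>#l. falling_fact (int q) i) ((q - d) * n + k)"
proof -
  let ?c = "\<Prod>i\<in>#l. falling_fact (int q) i"
  have "q * (n - size l) + q * size l = q * n"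
    using assms(3) by (simp flip: distrib_left)
  moreover have "(q - d) * n + k + sum_mset l = q * n"
  proof -
    have "(q - d) * n + d * n = q * n"
      using assms(1) by (simp flip: distrib_right)
    then show ?thesis using assms(2) by (simp add: mult.commute)
  qed
  ultimately have exponent: "q * (n - size l) + q * size l = (q - d) * n + k + sum_mset l"
    by simp
  have "monom 1 q ^ (n - size l) * (\<Prod>i\<in>#l. (pderiv ^^ i) (monom 1 q)) * monom (1 :: int) (sum_mset l) =
      monom ?c (q * (n - size l) + q * size l)"
    by (simp add: mult.assoc prod_higher_pderiv_monom monom_power mult_monom mult.commute[of _ q])
  also have "\<dots> = monom ?c ((q - d) * n + k) * monom 1 (sum_mset l)"
    by (simp add: exponent mult_monom)
  finally show ?thesis by simp
qed

theorem proposition6p18: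
  fixes n d q k :: nat
  assumes "1 \<le> n" and "1 \<le> d" and "d \<le> q"
  shows "gen_stirling q d n k =
    (\<Sum>l | is_partition l \<and> sum_mset l + k = n * d \<and> size l \<le> n - 1.
      c_coeff n d l * (\<Prod>i\<in>#l. falling_fact (int q) i))"
proof -
  let ?L = "\<lambda>k. {l. is_partition l \<and> sum_mset l + k = n * d \<and> size l \<le> n - 1}"
  let ?ff = "\<lambda>l. \<Prod>i\<in>#l. falling_fact (int q) i"
  define S where "S k = (\<Sum>l\<in>?L k. c_coeff n d l * ?ff l)" for k
  have support: "{k. S k \<noteq> 0} \<subseteq> {d..n * d}"
  proof
    fix k assume "k \<in> {k. S k \<noteq> 0}"
    then obtain l where l: "l \<in> ?L k" "c_coeff n d l \<noteq> 0"
      by (auto simp: S_def elim!: sum.not_neutral_contains_not_neutral)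
    \<comment> \<open>For \<open>k < d\<close> the partition is too large for its coefficient to be nonzero.\<close>
    from l(2) have "sum_mset l \<le> (n - 1) * d"
      by (auto simp: c_coeff_def split: if_splits)
    moreover have "(n - 1) * d + d = n * d"
      using assms(1) by (cases n) simp_all
    ultimately show "k \<in> {d..n * d}" using l(1) by auto
  qed
  then have fin: "finite {k. S k \<noteq> 0}" by (rule finite_subset) simp
  have "(xD q d ^^ n) p =
      monom 1 ((q - d) * n) * (\<Sum>k | S k \<noteq> 0. smult (S k) (xD k k p))" for p
  proof -
    have "(xD q d ^^ n) p = (\<Sum>k = d..n * d. \<Sum>l\<in>?L k. smult (c_coeff n d l)
        (monom 1 q ^ (n - size l) * (\<Prod>i\<in>#l. (pderiv ^^ i) (monom 1 q)) * (pderiv ^^ k) p))"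
      unfolding xD_def[abs_def] power_f_pderiv_expansion[OF assms(1,2)]
      by (intro sum.cong) auto
    also have "\<dots> = (\<Sum>k = d..n * d. \<Sum>l\<in>?L k.
        monom 1 ((q - d) * n) * smult (c_coeff n d l * ?ff l) (xD k k p))"
    proof (intro sum.cong refl)
      fix k l assume "l \<in> ?L k"
      then have "sum_mset l + k = n * d" "size l \<le> n" by auto
      then have "monom 1 q ^ (n - size l) * (\<Prod>i\<in>#l. (pderiv ^^ i) (monom 1 q)) =
          smult (?ff l) (monom 1 ((q - d) * n) * monom 1 k)"
        using partition_term_monom[OF assms(3), of l k n] by (simp add: mult_monom smult_monom)
      then show "smult (c_coeff n d l)
          (monom 1 q ^ (n - size l) * (\<Prod>i\<in>#l. (pderiv ^^ i) (monom 1 q)) * (pderiv ^^ k) p) =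
          monom 1 ((q - d) * n) * smult (c_coeff n d l * ?ff l) (xD k k p)"
        by (simp add: xD_def mult.assoc)
    qed
    also have "\<dots> = monom 1 ((q - d) * n) * (\<Sum>k = d..n * d. smult (S k) (xD k k p))"
      by (simp add: S_def smult_sum sum_distrib_left)
    also have "(\<Sum>k = d..n * d. smult (S k) (xD k k p)) = (\<Sum>k | S k \<noteq> 0. smult (S k) (xD k k p))"
      by (rule sum.mono_neutral_right) (use support in auto)
    finally show ?thesis .
  qed
  with fin have "is_gen_stirling q d n S"
    by (simp add: is_gen_stirling_def)
  then have "gen_stirling q d n = S"
    by (rule gen_stirling_unique[OF is_gen_stirling_gen_stirling[OF assms(3)]])
  then show ?thesis by (simp add: S_def)
qed

end
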